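(* Let $G$ be a finite nilpotent group whose order has at least three distinct prime divisors. Then the difference graph $\mathcal{D}(G)$ is perfect if and only if $G\cong\mathbb{Z}_{p_1p_2p_3}$ for distinct primes $p_1,p_2,p_3$.
   Context: For a finite group $G$ with identity $e$: the intersection power graph $\mathcal{G}_I(G)$ has vertex set $G$, two distinct non-identity vertices $x,y$ being adjacent iff $\langle x\rangle\cap\langle y\rangle\neq\{e\}$, and $e$ being adjacent to every other vertex. The power graph $\mathcal{P}(G)$ has vertex set $G$, two distinct vertices being adjacent iff one is a power of the other. The difference graph $\mathcal{D}(G)$ is the graph on vertex set $G$ with edge set $E(\mathcal{G}_I(G))\setminus E(\mathcal{P}(G))$, with all isolated vertices removed. *)

theory Defs
  imports "HOL-Algebra.Algebra" "HOL-Computational_Algebra.Primes"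
begin

definition commutator_subgroup :: "('a, 'b) monoid_scheme \<Rightarrow> 'a set \<Rightarrow> 'a set \<Rightarrow> 'a set" where
  "commutator_subgroup G H K = generate G
     {x \<otimes>\<^bsub>G\<^esub> y \<otimes>\<^bsub>G\<^esub> inv\<^bsub>G\<^esub> x \<otimes>\<^bsub>G\<^esub> inv\<^bsub>G\<^esub> y | x y. x \<in> H \<and> y \<in> K}"

primrec lower_central_series :: "('a, 'b) monoid_scheme \<Rightarrow> nat \<Rightarrow> 'a set" where
  "lower_central_series G 0 = carrier G"
| "lower_central_series G (Suc n) = commutator_subgroup G (lower_central_series G n) (carrier G)"

definition nilpotent_group :: "('a, 'b) monoid_scheme \<Rightarrow> bool" where
  "nilpotent_group G \<longleftrightarrow> group G \<and> (\<exists>n. lower_central_series G n = {\<one>\<^bsub>G\<^esub>})"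

definition ipg_adj :: "('a, 'b) monoid_scheme \<Rightarrow> 'a \<Rightarrow> 'a \<Rightarrow> bool" where
  "ipg_adj G x y \<longleftrightarrow> x \<in> carrier G \<and> y \<in> carrier G \<and> x \<noteq> y \<and>
     (x = \<one>\<^bsub>G\<^esub> \<or> y = \<one>\<^bsub>G\<^esub> \<or>
      generate G {x} \<inter> generate G {y} \<noteq> {\<one>\<^bsub>G\<^esub>})"

definition pg_adj :: "('a, 'b) monoid_scheme \<Rightarrow> 'a \<Rightarrow> 'a \<Rightarrow> bool" where
  "pg_adj G x y \<longleftrightarrow> x \<in> carrier G \<and> y \<in> carrier G \<and> x \<noteq> y \<and>
     ((\<exists>n::int. x = y [^]\<^bsub>G\<^esub> n) \<or> (\<exists>n::int. y = x [^]\<^bsub>G\<^esub> n))"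

definition diff_adj :: "('a, 'b) monoid_scheme \<Rightarrow> 'a \<Rightarrow> 'a \<Rightarrow> bool" where
  "diff_adj G x y \<longleftrightarrow> ipg_adj G x y \<and> \<not> pg_adj G x y"

definition diff_vertices :: "('a, 'b) monoid_scheme \<Rightarrow> 'a set" where
  "diff_vertices G = {x \<in> carrier G. \<exists>y. diff_adj G x y}"

definition is_clique :: "('v \<Rightarrow> 'v \<Rightarrow> bool) \<Rightarrow> 'v set \<Rightarrow> bool" where
  "is_clique E K \<longleftrightarrow> (\<forall>x\<in>K. \<forall>y\<in>K. x \<noteq> y \<longrightarrow> E x y)"

definition clique_number :: "'v set \<Rightarrow> ('v \<Rightarrow> 'v \<Rightarrow> bool) \<Rightarrow> nat" where
  "clique_number V E = Max {card K | K. K \<subseteq> V \<and> is_clique E K}"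

definition proper_colouring :: "'v set \<Rightarrow> ('v \<Rightarrow> 'v \<Rightarrow> bool) \<Rightarrow> nat \<Rightarrow> ('v \<Rightarrow> nat) \<Rightarrow> bool" where
  "proper_colouring V E k f \<longleftrightarrow> (\<forall>x\<in>V. f x < k) \<and> (\<forall>x\<in>V. \<forall>y\<in>V. E x y \<longrightarrow> f x \<noteq> f y)"

definition chromatic_number :: "'v set \<Rightarrow> ('v \<Rightarrow> 'v \<Rightarrow> bool) \<Rightarrow> nat" where
  "chromatic_number V E = (LEAST k. \<exists>f. proper_colouring V E k f)"

definition perfect_graph :: "'v set \<Rightarrow> ('v \<Rightarrow> 'v \<Rightarrow> bool) \<Rightarrow> bool" where
  "perfect_graph V E \<longleftrightarrow> (\<forall>S\<subseteq>V. chromatic_number S E = clique_number S E)"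

end

(*
  In Z_pqr an element with a neighbour has order pq, pr or qr, and two
  such elements are adjacent exactly when their orders differ, so the graph is complete multipartite
  and hence perfect. In every other case the graph contains an induced 5-cycle. By nilpotency elements
  of coprime order commute, so one of the following occurs (p, q, r, s distinct primes):
    an element of order pqrs, whose powers of orders pq, qr, rs, pqr, qrs form a 5-cycle;
    an element of order p^2qr, whose powers of orders p^2, pq, qr, p^2q, pqr form a 5-cycle;
    elements x, x' of order p with x' not in <x>, and y, z of orders q, r: then
    xyz, x'y, yz, xz, x'yz form a 5-cycle.
*)
theory Submission
  imports Defs
begin

section \<open>Cliques, colourings and perfection of finite graphs\<close>

lemma clique_card_le_colours:
  assumes "proper_colouring V E k f" "K \<subseteq> V" "is_clique E K"
  shows "card K \<le> k"
proof -
  have "inj_on f K"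
    using assms unfolding proper_colouring_def is_clique_def inj_on_def by (meson subsetD)
  moreover have "f ` K \<subseteq> {..<k}"
    using assms unfolding proper_colouring_def by auto
  ultimately show ?thesis
    by (metis card_image card_lessThan card_mono finite_lessThan)
qed

lemma finite_clique_cards:
  assumes "finite V"
  shows "finite {card K | K. K \<subseteq> V \<and> is_clique E K}"
proof -
  have "{card K | K. K \<subseteq> V \<and> is_clique E K} \<subseteq> card ` Pow V" by auto
  with assms show ?thesis by (meson finite_Pow_iff finite_imageI finite_subset)
qed

lemma clique_number_le:
  assumes "finite V" "\<And>K. K \<subseteq> V \<Longrightarrow> is_clique E K \<Longrightarrow> card K \<le> m"
  shows "clique_number V E \<le> m"
proof -
  have "card {} \<in> {card K | K. K \<subseteq> V \<and> is_clique E K}"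
    unfolding is_clique_def by (intro CollectI exI[of _ "{}"]) simp
  then show ?thesis
    unfolding clique_number_def using assms finite_clique_cards[OF assms(1)]
    by (subst Max_le_iff) blast+
qed

lemma clique_number_ge:
  assumes "finite V" "K \<subseteq> V" "is_clique E K"
  shows "card K \<le> clique_number V E"
  unfolding clique_number_def using assms
  by (intro Max_ge finite_clique_cards) auto

text \<open>The \<open>LEAST\<close> in \<open>chromatic_number\<close> is attained only if some
  colouring exists. Numbering the vertices injectively gives one, because no vertex is adjacent to
  itself.\<close>

lemma chromatic_number_colouring:
  assumes "finite V" "\<And>x. x \<in> V \<Longrightarrow> \<not> E x x"
  shows "\<exists>f. proper_colouring V E (chromatic_number V E) f"
proof -
  obtain f where f: "bij_betw f V {0..<card V}"
    using assms(1) ex_bij_betw_finite_nat by blast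
  have "proper_colouring V E (card V) f"
    using f assms(2) unfolding proper_colouring_def bij_betw_def inj_on_def
    by (metis atLeastLessThan_iff image_eqI)
  then show ?thesis
    unfolding chromatic_number_def
    by (intro LeastI_ex[of "\<lambda>k. \<exists>f. proper_colouring V E k f"]) blast
qed

text \<open>In every induced subgraph the classes of \<open>c\<close> can serve as colours, while
  one representative per class forms a clique of the same size. Any such clique bounds the number of
  colours from below, so both invariants equal the number of classes.\<close>

lemma complete_multipartite_perfect:
  assumes "finite V" and E: "\<And>x y. x \<in> V \<Longrightarrow> y \<in> V \<Longrightarrow> E x y \<longleftrightarrow> c x \<noteq> c y"
  shows "perfect_graph V E"
  unfolding perfect_graph_def
proof (intro allI impI)
  fix S assume S: "S \<subseteq> V"
  then have fin: "finite S" using assms(1) finite_subset by blast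
  \<comment> \<open>\<open>K\<close> is a transversal of the classes that meet
    \<open>S\<close>.\<close>
  obtain K where K: "K \<subseteq> S" "inj_on c K" "c ` S = c ` K"
    by (metis subset_image_inj subset_refl)
  have cl: "is_clique E K"
    using K S E unfolding is_clique_def inj_on_def by (meson subsetD)
  \<comment> \<open>Colours have to be an initial segment of the naturals, so \<open>b\<close>
    renumbers the class labels.\<close>
  obtain b where b: "bij_betw b (c ` S) {0..<card (c ` S)}"
    using fin ex_bij_betw_finite_nat by blast
  have "b (c x) < card (c ` S)" if "x \<in> S" for x
    using b that by (metis atLeastLessThan_iff bij_betwE image_eqI)
  moreover have "b (c x) \<noteq> b (c y)" if "x \<in> S" "y \<in> S" "E x y" for x y
    using b that E S unfolding bij_betw_def inj_on_def by (metis image_eqI subsetD)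
  ultimately have col: "proper_colouring S E (card (c ` S)) (b \<circ> c)"
    unfolding proper_colouring_def by auto
  have cardK: "card K = card (c ` S)"
    using K card_image by metis
  have "chromatic_number S E = card (c ` S)"
    unfolding chromatic_number_def
    using col clique_card_le_colours[OF _ K(1) cl] cardK
    by (intro Least_equality) auto
  moreover have "clique_number S E = card (c ` S)"
    using clique_number_ge[OF fin K(1) cl] cardK
      clique_number_le[OF fin clique_card_le_colours[OF col]] by force
  ultimately show "chromatic_number S E = clique_number S E" by simp
qed

text \<open>A 5-cycle has no triangle, hence clique number at most 2, but being an odd cycle it has
  no colouring with two colours.\<close>

lemma induced_pentagon_not_perfect:
  assumes V: "{a, b, c, d, e} \<subseteq> V"
    and sym: "\<And>x y. E x y \<Longrightarrow> E y x" and irrefl: "\<And>x. \<not> E x x"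
    and edges: "E a b" "E b c" "E c d" "E d e" "E e a"
    and non: "\<not> E a c" "\<not> E a d" "\<not> E b d" "\<not> E b e" "\<not> E c e"
  shows "\<not> perfect_graph V E"
proof
  assume perfect: "perfect_graph V E"
  let ?S = "{a, b, c, d, e}"
  \<comment> \<open>Identifying two vertices at distance two would turn an edge into one of the
    forbidden ones. A clique can therefore contain no such pair and lies within two consecutive
    vertices.\<close>
  have ne: "a \<noteq> c" "a \<noteq> d" "b \<noteq> d" "b \<noteq> e" "c \<noteq> e"
    using edges non sym by blast+
  have "card K \<le> 2" if K: "K \<subseteq> ?S" "is_clique E K" for K
  proof -
    have n: "\<not> (a \<in> K \<and> c \<in> K)" "\<not> (a \<in> K \<and> d \<in> K)" "\<not> (b \<in> K \<and> d \<in> K)"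
      "\<not> (b \<in> K \<and> e \<in> K)" "\<not> (c \<in> K \<and> e \<in> K)"
      using K(2) ne non unfolding is_clique_def by blast+
    have "\<exists>u v. K \<subseteq> {u, v}"
    proof (cases "a \<in> K")
      case True
      with n K(1) have "K \<subseteq> {a, b} \<or> K \<subseteq> {a, e}" by blast
      then show ?thesis by blast
    next
      case False
      with n K(1) have "K \<subseteq> {b, c} \<or> K \<subseteq> {c, d} \<or> K \<subseteq> {d, e}" by blast
      then show ?thesis by blast
    qed
    then obtain u v where "K \<subseteq> {u, v}" by blast
    then have "card K \<le> card {u, v}" by (simp add: card_mono)
    also have "\<dots> \<le> 2" by (simp add: card_insert_if)
    finally show ?thesis .
  qed
  then have "clique_number ?S E \<le> 2" by (intro clique_number_le) auto
  moreover obtain f where "proper_colouring ?S E (chromatic_number ?S E) f"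
    using chromatic_number_colouring[of ?S E] irrefl by auto
  moreover have "chromatic_number ?S E = clique_number ?S E"
    using perfect V unfolding perfect_graph_def by blast
  ultimately have "f a < 2" "f b < 2" "f c < 2" "f d < 2" "f e < 2"
    "f a \<noteq> f b" "f b \<noteq> f c" "f c \<noteq> f d" "f d \<noteq> f e" "f e \<noteq> f a"
    using edges unfolding proper_colouring_def by auto
  \<comment> \<open>With two colours \<open>a\<close>, \<open>c\<close> and \<open>e\<close> would
    agree, contradicting the edge from \<open>e\<close> to \<open>a\<close>.\<close>
  then show False by linarith
qed

section \<open>Elements of coprime order commute in a nilpotent group\<close>

context group
begin

lemma inv_cancel_left:
  assumes "x \<in> carrier G" "y \<in> carrier G"
  shows "inv x \<otimes> (x \<otimes> y) = y" "x \<otimes> (inv x \<otimes> y) = y"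
  using assms by (simp_all add: m_assoc[symmetric])

lemma pow_conjugate:
  assumes "x \<in> carrier G" "y \<in> carrier G"
  shows "(x \<otimes> y \<otimes> inv x) [^] (n::nat) = x \<otimes> y [^] n \<otimes> inv x"
proof (induction n)
  case (Suc n)
  have "x \<otimes> y [^] n \<otimes> inv x \<otimes> (x \<otimes> y \<otimes> inv x) = x \<otimes> (y [^] n \<otimes> y) \<otimes> inv x"
    using assms by (simp add: m_assoc) (simp add: m_assoc[symmetric])
  with Suc show ?case by simp
qed (use assms in simp)

text \<open>Conjugation by \<open>x\<close> sends \<open>y\<close> to \<open>c\<close> times
  \<open>y\<close>, so the \<open>n\<close>-th power of this product is trivial as well. Since
  \<open>c\<close> commutes with \<open>y\<close>, that power splits and leaves the
  \<open>n\<close>-th power of \<open>c\<close>.\<close>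

lemma pow_eq_one_of_central_commutator:
  assumes xyc: "x \<in> carrier G" "y \<in> carrier G" "c \<in> carrier G"
    and conj: "x \<otimes> y = c \<otimes> y \<otimes> x" and comm: "c \<otimes> y = y \<otimes> c" and "y [^] (n::nat) = \<one>"
  shows "c [^] n = \<one>"
proof -
  have "x \<otimes> y \<otimes> inv x = c \<otimes> y"
    using xyc conj by (simp add: m_assoc)
  then have "(c \<otimes> y) [^] n = \<one>"
    using pow_conjugate[OF xyc(1,2), of n] assms by simp
  with pow_mult_distrib[OF comm] assms show ?thesis by simp
qed

text \<open>Here \<open>c\<close> is the commutator of \<open>x\<close> and \<open>y\<close>.
  Swapping \<open>x\<close> and \<open>y\<close> replaces it by its inverse, so the preceding lemma
  applies twice and the order of \<open>c\<close> divides both \<open>m\<close> and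
  \<open>n\<close>.\<close>

lemma central_commutator_trivial_of_coprime:
  assumes xyc: "x \<in> carrier G" "y \<in> carrier G" "c \<in> carrier G"
    and conj: "x \<otimes> y = c \<otimes> y \<otimes> x"
    and comm: "c \<otimes> y = y \<otimes> c" "c \<otimes> x = x \<otimes> c"
    and pow: "x [^] (m::nat) = \<one>" "y [^] (n::nat) = \<one>" and "coprime m n"
  shows "c = \<one>"
proof -
  have "y \<otimes> x = inv c \<otimes> x \<otimes> y"
    using xyc conj by (simp add: m_assoc) (simp add: m_assoc[symmetric])
  moreover have "inv c \<otimes> x = x \<otimes> inv c"
    using comm(2) xyc by (metis inv_closed inv_solve_left inv_solve_right m_assoc m_closed)
  ultimately have "inv c [^] m = \<one>"
    using pow_eq_one_of_central_commutator xyc pow(1) by blast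
  moreover have "c [^] n = \<one>"
    using pow_eq_one_of_central_commutator conj comm(1) xyc pow(2) by blast
  ultimately have "ord c dvd m" "ord c dvd n"
    using xyc by (metis inv_closed ord_inv pow_eq_id, metis pow_eq_id)
  then have "ord c = 1"
    using \<open>coprime m n\<close> coprime_common_divisor_nat by blast
  then show ?thesis using ord_eq_1 xyc by simp
qed

text \<open>Conjugation by \<open>g\<close> carries the commutator of \<open>x\<close> and
  \<open>y\<close> to that of their conjugates, and the conjugate of \<open>x\<close> stays in
  \<open>N\<close>. Normality of the terms of the series is what permits passing to quotients
  below.\<close>

lemma commutator_subgroup_normal:
  assumes N: "N \<lhd> G"
  shows "commutator_subgroup G N (carrier G) \<lhd> G"
  unfolding commutator_subgroup_def
proof (rule normal_generateI)
  interpret normal N G by (rule N)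
  show "{x \<otimes> y \<otimes> inv x \<otimes> inv y |x y. x \<in> N \<and> y \<in> carrier G} \<subseteq> carrier G"
    by auto
  fix h g
  assume "h \<in> {x \<otimes> y \<otimes> inv x \<otimes> inv y |x y. x \<in> N \<and> y \<in> carrier G}" and g: "g \<in> carrier G"
  then obtain x y where xy: "x \<in> N" "y \<in> carrier G" "h = x \<otimes> y \<otimes> inv x \<otimes> inv y" by blast
  then have x: "x \<in> carrier G" by auto
  have "g \<otimes> h \<otimes> inv g =
    (g \<otimes> x \<otimes> inv g) \<otimes> (g \<otimes> y \<otimes> inv g) \<otimes> inv (g \<otimes> x \<otimes> inv g) \<otimes> inv (g \<otimes> y \<otimes> inv g)"
    using g x xy(2) unfolding xy(3) by (simp add: inv_mult_group m_assoc inv_cancel_left)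
  moreover have "g \<otimes> x \<otimes> inv g \<in> N" using g xy(1) by (simp add: inv_op_closed2)
  ultimately show "g \<otimes> h \<otimes> inv g \<in> {x \<otimes> y \<otimes> inv x \<otimes> inv y |x y. x \<in> N \<and> y \<in> carrier G}"
    using g xy(2) by blast
qed

lemma lower_central_series_normal: "lower_central_series G n \<lhd> G"
  by (induction n) (simp_all add: normal_self commutator_subgroup_normal)

text \<open>Modulo the next term of the series the commutator is central, so both coprime orders annihilate it.\<close>
lemma commutator_in_lower_central_series:
  assumes x: "x \<in> carrier G" and y: "y \<in> carrier G" and "coprime (ord x) (ord y)"
  shows "x \<otimes> y \<otimes> inv x \<otimes> inv y \<in> lower_central_series G n"
proof (induction n)
  case (Suc n)
  define c where "c = x \<otimes> y \<otimes> inv x \<otimes> inv y"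
  define N where "N = lower_central_series G (Suc n)"
  have c: "c \<in> carrier G" using x y by (simp add: c_def)
  interpret N: normal N G unfolding N_def by (rule lower_central_series_normal)
  interpret Q: group "G Mod N" by (rule N.factorgroup_is_group)
  interpret h: group_hom G "G Mod N" "\<lambda>a. N #> a"
    by (simp add: N.r_coset_hom_Mod group_hom.intro group_hom_axioms.intro is_group Q.is_group)
  have ker: "N #> a = \<one>\<^bsub>G Mod N\<^esub> \<longleftrightarrow> a \<in> N" if "a \<in> carrier G" for a
    using that by (simp add: FactGroup_def) (metis N.is_subgroup coset_join1 coset_join2)
  have central: "(N #> c) \<otimes>\<^bsub>G Mod N\<^esub> (N #> g) = (N #> g) \<otimes>\<^bsub>G Mod N\<^esub> (N #> c)"
    if g: "g \<in> carrier G" for g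
  proof -
    \<comment> \<open>By induction \<open>c\<close> lies in the current term, so its commutator with
      any \<open>g\<close> lies in the next term \<open>N\<close> and vanishes in the
      quotient.\<close>
    define k where "k = c \<otimes> g \<otimes> inv c \<otimes> inv g"
    have "k \<in> N"
      using Suc g unfolding N_def c_def[symmetric] k_def
      by (auto simp: commutator_subgroup_def intro!: generate.incl)
    moreover have "c \<otimes> g = k \<otimes> (g \<otimes> c)"
      using g c by (simp add: k_def m_assoc inv_cancel_left)
    ultimately show ?thesis using g c ker by (metis Q.l_one h.hom_closed h.hom_mult m_closed N.mem_carrier)
  qed
  have "x \<otimes> y = c \<otimes> y \<otimes> x"
    using x y by (simp add: c_def m_assoc)
  then have "(N #> x) \<otimes>\<^bsub>G Mod N\<^esub> (N #> y) = (N #> c) \<otimes>\<^bsub>G Mod N\<^esub> (N #> y) \<otimes>\<^bsub>G Mod N\<^esub> (N #> x)"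
    using x y c by (metis h.hom_mult m_closed)
  \<comment> \<open>The exponents are the orders in \<open>G\<close> itself, so their coprimality
    can be used in the quotient directly.\<close>
  moreover have "(N #> a) [^]\<^bsub>G Mod N\<^esub> ord a = \<one>\<^bsub>G Mod N\<^esub>" if "a \<in> carrier G" for a
    using that by (metis h.hom_nat_pow h.hom_one pow_ord_eq_1)
  ultimately have "N #> c = \<one>\<^bsub>G Mod N\<^esub>"
    using x y c assms(3)
    by (intro Q.central_commutator_trivial_of_coprime[of "N #> x" "N #> y" "N #> c" "ord x" "ord y"]
        central h.hom_closed)
  with ker c show ?case unfolding N_def c_def by blast
qed (use x y in simp)

text \<open>The commutator lies in every term of the lower central series, and some term is
  trivial.\<close>

lemma nilpotent_coprime_commute:
  assumes "nilpotent_group G"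
    and x: "x \<in> carrier G" and y: "y \<in> carrier G" and "coprime (ord x) (ord y)"
  shows "x \<otimes> y = y \<otimes> x"
proof -
  have "x \<otimes> y \<otimes> inv x \<otimes> inv y = \<one>"
    using commutator_in_lower_central_series[OF x y] assms unfolding nilpotent_group_def by blast
  then show ?thesis using x y
    by (metis inv_closed inv_equality inv_inv m_assoc m_closed inv_mult_group)
qed

end

section \<open>Adjacency in terms of cyclic subgroups and orders\<close>

lemma diff_adj_sym: "diff_adj G x y \<Longrightarrow> diff_adj G y x"
  unfolding diff_adj_def ipg_adj_def pg_adj_def by (metis Int_commute)

lemma diff_adj_irrefl: "\<not> diff_adj G x x"
  by (simp add: diff_adj_def ipg_adj_def)

context group
begin

text \<open>The identity lies in every cyclic subgroup, hence is joined to everything in the power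
  graph and has no edge in the difference. This absorbs its special treatment in
  \<open>ipg_adj\<close>, and \<open>x = y\<close> is excluded because \<open>x\<close> generates
  itself.\<close>

lemma diff_adj_iff:
  assumes "x \<in> carrier G" "y \<in> carrier G"
  shows "diff_adj G x y \<longleftrightarrow>
    generate G {x} \<inter> generate G {y} \<noteq> {\<one>} \<and> x \<notin> generate G {y} \<and> y \<notin> generate G {x}"
proof -
  have "\<one> \<in> generate G {z}" "z \<in> generate G {z}" for z
    by (simp_all add: generate.one generate.incl)
  moreover have "pg_adj G x y \<longleftrightarrow> x \<noteq> y \<and> (x \<in> generate G {y} \<or> y \<in> generate G {x})"
    using assms unfolding pg_adj_def generate_pow[OF assms(1)] generate_pow[OF assms(2)] by blast
  ultimately show ?thesis
    using assms unfolding diff_adj_def ipg_adj_def by blast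
qed

lemma generate_singleton_mono:
  assumes "x \<in> carrier G" "y \<in> generate G {x}"
  shows "generate G {y} \<subseteq> generate G {x}"
proof (rule generate_subgroup_incl)
  show "{y} \<subseteq> generate G {x}" using assms(2) by blast
  show "subgroup (generate G {x}) G" using assms(1) by (simp add: generate_is_subgroup)
qed

lemma ord_dvd_of_mem_generate:
  assumes "y \<in> carrier G" "x \<in> generate G {y}"
  shows "ord x dvd ord y"
proof -
  obtain k :: int where k: "x = y [^] k" using assms by (auto simp: generate_pow)
  have "x [^] int (ord y) = (y [^] int (ord y)) [^] k"
    using assms by (simp add: k int_pow_pow mult.commute)
  then have "x [^] ord y = \<one>" using assms by (simp add: int_pow_int)
  with assms k show ?thesis by (simp add: pow_eq_id[symmetric])
qed

lemma generate_Int_trivial_of_coprime: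
  assumes "x \<in> carrier G" "y \<in> carrier G" "coprime (ord x) (ord y)"
  shows "generate G {x} \<inter> generate G {y} = {\<one>}"
proof -
  have "w = \<one>" if "w \<in> generate G {x}" "w \<in> generate G {y}" for w
  proof -
    have "ord w = 1"
      using that assms ord_dvd_of_mem_generate coprime_common_divisor_nat by metis
    then show ?thesis using that assms ord_eq_1 generate_in_carrier[of "{x}" w] by auto
  qed
  then show ?thesis by (auto simp: generate.one)
qed

text \<open>A finite cyclic group has exactly one subgroup of each possible order, so containment of
  cyclic subgroups is divisibility of orders.\<close>

lemma mem_generate_iff_ord_dvd:
  assumes g: "g \<in> carrier G" "ord g \<noteq> 0" and x: "x \<in> generate G {g}" and y: "y \<in> generate G {g}"
  shows "x \<in> generate G {y} \<longleftrightarrow> ord x dvd ord y"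
proof
  have yc: "y \<in> carrier G" using g y generate_in_carrier[of "{g}" y] by auto
  show "ord x dvd ord y" if "x \<in> generate G {y}"
    using that yc ord_dvd_of_mem_generate by blast
  assume dvd: "ord x dvd ord y"
  obtain i j :: nat where ij: "x = g [^] i" "y = g [^] j"
    using x y g by (auto simp: generate_pow_nat)
  \<comment> \<open>The subgroup of \<open>y\<close> is also generated by the \<open>d\<close>-th
    power of \<open>g\<close>, and has index \<open>d\<close> in that of \<open>g\<close>.
    Divisibility of the orders then becomes \<open>d dvd i\<close>.\<close>
  define d where "d = gcd (ord g) j"
  have yd: "ord y * d = ord g"
    using g unfolding ij d_def by (cases "j = 0") (auto simp: ord_pow_gen)
  have "g [^] (i * ord y) = \<one>"
    using dvd g by (metis ij(1) nat_pow_pow nat_pow_closed pow_eq_id)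
  then have "ord g dvd i * ord y" using g(1) pow_eq_id by blast
  then have "ord y * d dvd ord y * i" by (simp only: yd) (simp add: mult.commute)
  moreover have "ord y \<noteq> 0" using yd g(2) by (cases "ord y = 0") auto
  ultimately have "d dvd i" by simp
  then obtain t where t: "i = d * t" by blast
  \<comment> \<open>Bezout turns the \<open>d\<close>-th power of \<open>g\<close> into the
    \<open>v\<close>-th power of \<open>y\<close>.\<close>
  obtain u v where uv: "int (ord g) * u + int j * v = int d"
    unfolding d_def using bezout_int[of "int (ord g)" "int j"] by (metis gcd_int_int_eq mult.commute)
  have "x = g [^] (int j * (v * int t))"
  proof -
    have "int j * (v * int t) - int d * int t = int (ord g) * (- u * int t)"
      unfolding uv[symmetric] by (simp add: algebra_simps)
    then show ?thesis
      using g t by (simp add: ij int_pow_int[symmetric] int_pow_eq)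
  qed
  then have "x = y [^] (v * int t)"
    using g by (simp add: ij int_pow_pow int_pow_int[symmetric])
  then show "x \<in> generate G {y}" using yc by (auto simp: generate_pow)
qed

lemma exists_ord_of_dvd:
  assumes "g \<in> carrier G" "ord g \<noteq> 0" "d dvd ord g"
  shows "\<exists>x \<in> generate G {g}. ord x = d"
proof -
  obtain t where t: "ord g = d * t" using assms(3) by blast
  with assms(2) have "ord (g [^] t) = d" using ord_pow[OF assms(1), of t] by simp
  then show ?thesis using assms by (auto simp: generate_pow_nat)
qed

lemma generate_Int_trivial_iff_coprime:
  assumes g: "g \<in> carrier G" "ord g \<noteq> 0" and x: "x \<in> generate G {g}" and y: "y \<in> generate G {g}"
  shows "generate G {x} \<inter> generate G {y} = {\<one>} \<longleftrightarrow> coprime (ord x) (ord y)"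
proof
  have c: "x \<in> carrier G" "y \<in> carrier G"
    using g x y generate_in_carrier[of "{g}"] by auto
  show "generate G {x} \<inter> generate G {y} = {\<one>}" if "coprime (ord x) (ord y)"
    using that c generate_Int_trivial_of_coprime by blast
  assume triv: "generate G {x} \<inter> generate G {y} = {\<one>}"
  have "ord x \<noteq> 0" using ord_dvd_of_mem_generate[OF g(1) x] g(2) by auto
  \<comment> \<open>The order of \<open>w\<close> divides that of \<open>y\<close>, so
    \<open>w\<close> lies in both subgroups and trivial intersection forces the gcd to be 1.\<close>
  then obtain w where w: "w \<in> generate G {x}" "ord w = gcd (ord x) (ord y)"
    using exists_ord_of_dvd[OF c(1)] by blast
  then have "w \<in> generate G {y}"
    using mem_generate_iff_ord_dvd[OF g _ y] generate_singleton_mono[OF g(1) x] by auto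
  with w triv have "w = \<one>" by blast
  with w(2) show "coprime (ord x) (ord y)" by (metis coprime_iff_gcd_eq_1 ord_id)
qed

text \<open>Inside one finite cyclic subgroup the orders alone decide adjacency. The first two
  pentagons and the perfect case thereby become statements about divisors of an integer.\<close>

lemma diff_adj_cyclic_iff:
  assumes g: "g \<in> carrier G" "ord g \<noteq> 0" and x: "x \<in> generate G {g}" and y: "y \<in> generate G {g}"
  shows "diff_adj G x y \<longleftrightarrow>
    \<not> coprime (ord x) (ord y) \<and> \<not> ord x dvd ord y \<and> \<not> ord y dvd ord x"
proof -
  have "x \<in> carrier G" "y \<in> carrier G"
    using g x y generate_in_carrier[of "{g}"] by auto
  then show ?thesis
    using diff_adj_iff generate_Int_trivial_iff_coprime[OF assms]
      mem_generate_iff_ord_dvd[OF g x y] mem_generate_iff_ord_dvd[OF g y x] by simp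
qed

lemma ord_mult_of_coprime:
  assumes "x \<in> carrier G" "y \<in> carrier G" "x \<otimes> y = y \<otimes> x" "coprime (ord x) (ord y)"
  shows "ord (x \<otimes> y) = ord x * ord y"
proof (rule dvd_antisym)
  show "ord (x \<otimes> y) dvd ord x * ord y" using assms ord_mul_divides by blast
  \<comment> \<open>Raising to the power \<open>ord (a \<otimes> b) * ord b\<close> kills both the
    product and \<open>b\<close>, hence also \<open>a\<close>. Coprimality then removes the factor
    \<open>ord b\<close>.\<close>
  have *: "ord a dvd ord (a \<otimes> b)"
    if ab: "a \<in> carrier G" "b \<in> carrier G" "a \<otimes> b = b \<otimes> a" "coprime (ord a) (ord b)" for a b
  proof -
    have "(a \<otimes> b) [^] (ord (a \<otimes> b) * ord b) = \<one>"
      using ab by (simp add: nat_pow_pow[symmetric])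
    moreover have "b [^] (ord (a \<otimes> b) * ord b) = \<one>" using ab by (simp add: pow_eq_id)
    ultimately have "a [^] (ord (a \<otimes> b) * ord b) = \<one>" using ab by (simp add: pow_mult_distrib)
    then show ?thesis using ab by (simp add: pow_eq_id coprime_dvd_mult_left_iff)
  qed
  show "ord x * ord y dvd ord (x \<otimes> y)"
    using *[of x y] *[of y x] assms by (metis coprime_commute divides_mult)
qed

text \<open>The powers of \<open>g\<close> indexed by the residues are distinct, and there are as
  many of them as elements of \<open>G\<close>.\<close>

lemma iso_integer_mod_group_of_ord_eq_order:
  assumes fin: "finite (carrier G)" and g: "g \<in> carrier G" "ord g = order G"
  shows "G \<cong> integer_mod_group (order G)"
proof -
  let ?n = "order G" and ?Z = "integer_mod_group (order G)"
  let ?f = "\<lambda>k::int. g [^] k"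
  have n: "?n > 0" using fin by (simp add: order_gt_0_iff_finite)
  then have Z: "carrier ?Z = {0..<int ?n}" by (simp add: carrier_integer_mod_group)
  have "?f \<in> hom ?Z G"
    using g by (auto simp: hom_def int_pow_mult[symmetric] int_pow_eq mod_eq_dvd_iff[symmetric])
  moreover have "bij_betw ?f (carrier ?Z) (carrier G)"
  proof -
    have "inj_on ?f (carrier ?Z)"
      unfolding Z using g
      by (auto simp: inj_on_def int_pow_eq mod_eq_dvd_iff[symmetric])
    moreover have "?f ` carrier ?Z \<subseteq> carrier G" using g by auto
    moreover have "card (carrier ?Z) = card (carrier G)" unfolding Z by (simp add: order_def)
    ultimately show ?thesis using fin by (metis bij_betw_def card_image card_subset_eq)
  qed
  ultimately have "?Z \<cong> G" unfolding is_iso_def iso_def by blast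
  then show ?thesis using group.iso_sym group_integer_mod_group by blast
qed

lemma exists_ord_of_iso_integer_mod_group:
  assumes "G \<cong> integer_mod_group n" "n > 1"
  shows "\<exists>g \<in> carrier G. ord g = n \<and> carrier G = generate G {g}"
proof -
  let ?Z = "integer_mod_group n"
  have "?Z \<cong> G" using assms(1) iso_sym by blast
  then obtain h where h: "h \<in> iso ?Z G" unfolding is_iso_def by blast
  then have hom: "h \<in> hom ?Z G" and bij: "bij_betw h (carrier ?Z) (carrier G)"
    by (auto simp: iso_def)
  interpret h: group_hom ?Z G h
    using hom by (simp add: group_hom_def group_hom_axioms_def is_group)
  have one: "1 \<in> carrier ?Z" using assms(2) by simp
  let ?g = "h 1"
  have g: "?g \<in> carrier G" using one by simp
  have pow: "?g [^] k = h (int k mod int n)" for k :: nat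
    using h.hom_nat_pow[OF one, of k] one by simp
  \<comment> \<open>The \<open>k\<close>-th power is the image of \<open>k\<close> modulo
    \<open>n\<close>, and \<open>h\<close> is injective with 0 sent to the identity.\<close>
  have "?g [^] k = \<one> \<longleftrightarrow> n dvd k" for k :: nat
  proof -
    have "int k mod int n \<in> carrier ?Z" using assms(2) by (simp add: carrier_integer_mod_group)
    moreover have "\<one> = h 0" using h.hom_one by simp
    ultimately have "?g [^] k = \<one> \<longleftrightarrow> int k mod int n = 0"
      using bij pow integer_mod_group_0 unfolding bij_betw_def inj_on_def by metis
    then show ?thesis by (simp add: zmod_int[symmetric] mod_eq_0_iff_dvd)
  qed
  then have ord: "ord ?g = n" using g ord_unique by blast
  have "card (carrier G) = card (carrier ?Z)" using bij bij_betw_same_card by metis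
  also have "\<dots> = n" using assms(2) by (simp add: carrier_integer_mod_group)
  finally have card: "card (carrier G) = n" .
  then have "finite (carrier G)" using assms(2) by (intro card_ge_0_finite) simp
  moreover have "generate G {?g} \<subseteq> carrier G" using g generate_incl by blast
  ultimately have "generate G {?g} = carrier G"
    using card ord generate_pow_card[OF g] card_subset_eq by metis
  with g ord show ?thesis by blast
qed

section \<open>Pentagons in cyclic subgroups\<close>

lemma mem_diff_vertices: "diff_adj G x y \<Longrightarrow> x \<in> diff_vertices G"
  unfolding diff_vertices_def diff_adj_def ipg_adj_def by blast

lemma induced_pentagon_diff_graph_not_perfect:
  assumes edges: "diff_adj G a b" "diff_adj G b c" "diff_adj G c d" "diff_adj G d e" "diff_adj G e a"
    and non: "\<not> diff_adj G a c" "\<not> diff_adj G a d" "\<not> diff_adj G b d" "\<not> diff_adj G b e"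
      "\<not> diff_adj G c e"
  shows "\<not> perfect_graph (diff_vertices G) (diff_adj G)"
proof (rule induced_pentagon_not_perfect[OF _ _ _ edges non])
  show "{a, b, c, d, e} \<subseteq> diff_vertices G"
    using edges mem_diff_vertices by blast
qed (simp_all add: diff_adj_sym diff_adj_irrefl)

text \<open>\<open>P\<close> names the adjacency relation between orders, so a pentagon amounts to
  ten arithmetic conditions on five divisors of \<open>ord g\<close>.\<close>

lemma cyclic_pentagon_not_perfect:
  fixes P :: "nat \<Rightarrow> nat \<Rightarrow> bool"
  assumes g: "g \<in> carrier G" "ord g \<noteq> 0"
    and P: "\<And>m n. P m n \<longleftrightarrow> \<not> coprime m n \<and> \<not> m dvd n \<and> \<not> n dvd m"
    and dvd: "a dvd ord g" "b dvd ord g" "c dvd ord g" "d dvd ord g" "e dvd ord g"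
    and edges: "P a b" "P b c" "P c d" "P d e" "P e a"
    and non: "\<not> P a c" "\<not> P a d" "\<not> P b d" "\<not> P b e" "\<not> P c e"
  shows "\<not> perfect_graph (diff_vertices G) (diff_adj G)"
proof -
  have adj: "diff_adj G x y \<longleftrightarrow> P (ord x) (ord y)"
    if "x \<in> generate G {g}" "y \<in> generate G {g}" for x y
    using diff_adj_cyclic_iff[OF g that] P by blast
  obtain xa xb xc xd xe where x: "xa \<in> generate G {g}" "xb \<in> generate G {g}" "xc \<in> generate G {g}"
      "xd \<in> generate G {g}" "xe \<in> generate G {g}"
    and ords: "ord xa = a" "ord xb = b" "ord xc = c" "ord xd = d" "ord xe = e"
    using exists_ord_of_dvd[OF g] dvd by metis
  show ?thesis
    by (rule induced_pentagon_diff_graph_not_perfect[of xa xb xc xd xe])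
      (simp_all only: adj x ords edges non not_False_eq_True)
qed

text \<open>Consecutive orders share a prime and neither divides the other. Of the five non-edges,
  \<open>p * q\<close> and \<open>r * s\<close> are coprime, and in the other four pairs one order
  divides the other.\<close>

lemma four_primes_not_perfect:
  assumes g: "g \<in> carrier G" and ord: "ord g = p * q * r * s"
    and pr: "Factorial_Ring.prime (p::nat)" "Factorial_Ring.prime q" "Factorial_Ring.prime r" "Factorial_Ring.prime s"
    and ne: "p \<noteq> q" "p \<noteq> r" "p \<noteq> s" "q \<noteq> r" "q \<noteq> s" "r \<noteq> s"
  shows "\<not> perfect_graph (diff_vertices G) (diff_adj G)"
proof -
  note [simp] = pr ne ne[symmetric] primes_coprime prime_dvd_mult_iff primes_dvd_imp_eq
  have nd: "\<not> t dvd u" if "Factorial_Ring.prime t" "Factorial_Ring.prime u" "t \<noteq> u" for t u :: nat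
    using that primes_dvd_imp_eq by blast
  have left: "\<not> t * v dvd u" and right: "\<not> v * t dvd u" if "\<not> t dvd u" for t u v :: nat
    using that dvd_mult_left dvd_mult_right by blast+
  have not1: "t \<noteq> Suc 0" if "Factorial_Ring.prime t" for t :: nat
    using that by auto
  show ?thesis
    by (rule cyclic_pentagon_not_perfect[OF g _ refl,
          of "p * q" "q * r" "r * s" "p * q * r" "q * r * s"])
      (auto simp: ord nd left right not1 prime_gt_0_nat)
qed

text \<open>The pattern is that of four primes: the coprime pair is now \<open>p * p\<close> and
  \<open>q * r\<close>, and the other four non-edges are again divisibilities.\<close>

lemma prime_square_not_perfect:
  assumes g: "g \<in> carrier G" and ord: "ord g = p * p * q * r"
    and pr: "Factorial_Ring.prime (p::nat)" "Factorial_Ring.prime q" "Factorial_Ring.prime r"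
    and ne: "p \<noteq> q" "p \<noteq> r" "q \<noteq> r"
  shows "\<not> perfect_graph (diff_vertices G) (diff_adj G)"
proof -
  note [simp] = pr ne ne[symmetric] primes_coprime prime_dvd_mult_iff primes_dvd_imp_eq
  have nd: "\<not> t dvd u" if "Factorial_Ring.prime t" "Factorial_Ring.prime u" "t \<noteq> u" for t u :: nat
    using that primes_dvd_imp_eq by blast
  have left: "\<not> t * v dvd u" and right: "\<not> v * t dvd u" if "\<not> t dvd u" for t u v :: nat
    using that dvd_mult_left dvd_mult_right by blast+
  have not1: "t \<noteq> Suc 0" if "Factorial_Ring.prime t" for t :: nat
    using that by auto
  show ?thesis
    by (rule cyclic_pentagon_not_perfect[OF g _ refl,
          of "p * p" "p * q" "q * r" "p * p * q" "p * q * r"])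
      (auto simp: ord nd left right not1 prime_gt_0_nat mult.assoc)
qed

section \<open>Elements of prescribed order from Sylow subgroups\<close>

lemma ord_dvd_card_subgroup:
  assumes H: "subgroup H G" and x: "x \<in> H"
  shows "ord x dvd card H"
proof -
  interpret H: group "G\<lparr>carrier := H\<rparr>" using H subgroup_imp_group by blast
  have "x [^]\<^bsub>G\<lparr>carrier := H\<rparr>\<^esub> card H = \<one>"
    using H.pow_order_eq_1[of x] x by (simp add: order_def)
  then have "x [^] card H = \<one>" by (simp only: nat_pow_consistent[symmetric])
  then show ?thesis using pow_eq_id[OF subgroup.mem_carrier[OF H x]] by simp
qed

text \<open>\<open>sylow_thm\<close> yields a subgroup for any prime power dividing the order,
  maximal or not. With exponent 1 it has \<open>p\<close> elements, and each nontrivial one has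
  order \<open>p\<close>.\<close>

lemma cauchy_prime_order:
  assumes "finite (carrier G)" "Factorial_Ring.prime p" "p dvd order G"
  shows "\<exists>x \<in> carrier G. ord x = p"
proof -
  obtain m where "order G = p ^ 1 * m" using assms(3) by auto
  then obtain H where H: "subgroup H G" "card H = p"
    using sylow_thm[OF assms(2) is_group _ assms(1), of 1 m] by auto
  have "\<not> H \<subseteq> {\<one>}"
    using H(2) prime_gt_1_nat[OF assms(2)] card_mono[of "{\<one>}" H] by auto
  then obtain x where x: "x \<in> H" "x \<noteq> \<one>" by blast
  have xc: "x \<in> carrier G" by (rule subgroup.mem_carrier[OF H(1) x(1)])
  then have "ord x \<noteq> 1" using x(2) ord_eq_1[OF xc] by simp
  then have "ord x = p"
    using ord_dvd_card_subgroup[OF H(1) x(1)] H(2) assms(2) by (auto simp: prime_nat_iff)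
  with xc show ?thesis by blast
qed

text \<open>This separates the second pentagon from the third. In a subgroup with
  \<open>p ^ 2\<close> elements but none of order \<open>p * p\<close>, all nontrivial elements have
  order \<open>p\<close>, and the \<open>p\<close> powers of one of them cannot exhaust the
  subgroup.\<close>

lemma ord_prime_square_or_noncyclic:
  assumes "finite (carrier G)" "Factorial_Ring.prime p" "p * p dvd order G"
  shows "(\<exists>x \<in> carrier G. ord x = p * p) \<or>
    (\<exists>x \<in> carrier G. \<exists>x' \<in> carrier G. ord x = p \<and> ord x' = p \<and> x' \<notin> generate G {x})"
proof -
  have p: "p > 1" using assms(2) prime_gt_1_nat by blast
  obtain m where "order G = p ^ 2 * m" using assms(3) by (auto simp: power2_eq_square)
  then obtain H where H: "subgroup H G" "card H = p ^ 2"
    using sylow_thm[OF assms(2) is_group _ assms(1), of 2 m] by blast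
  have carr: "x \<in> carrier G" if "x \<in> H" for x
    by (rule subgroup.mem_carrier[OF H(1) that])
  have ords: "ord x = 1 \<or> ord x = p \<or> ord x = p * p" if "x \<in> H" for x
  proof -
    have "ord x dvd p ^ 2" using ord_dvd_card_subgroup[OF H(1) that] H(2) by simp
    then obtain i where "i \<le> 2" "ord x = p ^ i" using divides_primepow_nat[OF assms(2)] by blast
    moreover from this(1) have "i = 0 \<or> i = 1 \<or> i = 2" by linarith
    ultimately show ?thesis by (auto simp: power2_eq_square)
  qed
  show ?thesis
  proof (cases "\<exists>x\<in>H. ord x = p * p")
    case True
    then show ?thesis using carr by blast
  next
    case False
    then have ordp: "ord x = p" if "x \<in> H" "x \<noteq> \<one>" for x
      using that ords[OF that(1)] ord_eq_1[OF carr[OF that(1)]] by blast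
    have big: "\<not> H \<subseteq> K" if "finite K" "card K \<le> p" for K
    proof
      assume "H \<subseteq> K"
      then have "p ^ 2 \<le> p" using card_mono[OF that(1), of H] H(2) that(2) by linarith
      with p show False by (simp add: power2_eq_square)
    qed
    obtain x where x: "x \<in> H" "x \<noteq> \<one>" using big[of "{\<one>}"] p by force
    have "generate G {x} \<subseteq> carrier G" using carr[OF x(1)] by (intro generate_incl) simp
    then have "finite (generate G {x})" using assms(1) finite_subset by blast
    moreover have "card (generate G {x}) \<le> p"
      using generate_pow_card[OF carr[OF x(1)]] ordp[OF x] by simp
    ultimately obtain x' where x': "x' \<in> H" "x' \<notin> generate G {x}" using big by blast
    then have "x' \<noteq> \<one>" using generate.one[of G "{x}"] by auto
    then show ?thesis using x x' ordp carr by blast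
  qed
qed

section \<open>Products of coprime order and the pentagon from a noncyclic
  \<open>p\<close>-part\<close>

lemma mem_generate_mult_of_coprime:
  assumes c: "x \<in> carrier G" "y \<in> carrier G" and "x \<otimes> y = y \<otimes> x" and "coprime (ord x) (ord y)"
  shows "x \<in> generate G {x \<otimes> y}" "y \<in> generate G {x \<otimes> y}"
proof -
  have *: "a \<in> generate G {a \<otimes> b}"
    if ab: "a \<in> carrier G" "b \<in> carrier G" "a \<otimes> b = b \<otimes> a" "coprime (ord a) (ord b)" for a b
  proof -
    \<comment> \<open>The exponent \<open>v * int (ord b)\<close> is 1 modulo \<open>ord a\<close>
      and 0 modulo \<open>ord b\<close>, so it extracts \<open>a\<close> from the product.\<close>
    obtain u v where uv: "u * int (ord a) + v * int (ord b) = 1"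
      using bezout_int[of "int (ord a)" "int (ord b)"] ab(4) by auto
    have "(a \<otimes> b) [^] (v * int (ord b)) = a [^] (v * int (ord b)) \<otimes> b [^] (v * int (ord b))"
      by (rule int_pow_mult_distrib[OF ab(3,1,2)])
    also have "b [^] (v * int (ord b)) = \<one>" using ab by (simp add: int_pow_eq_id)
    also have "a [^] (v * int (ord b)) = a [^] (1::int)"
    proof -
      have "1 - v * int (ord b) = u * int (ord a)" using uv by simp
      then show ?thesis using ab by (simp add: int_pow_eq del: int_pow_1)
    qed
    finally have "a = (a \<otimes> b) [^] (v * int (ord b))" using ab by simp
    then show ?thesis using ab(1,2) generate_pow[of "a \<otimes> b"] by blast
  qed
  show "x \<in> generate G {x \<otimes> y}" using assms * by blast
  show "y \<in> generate G {x \<otimes> y}"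
    using *[of y x] assms by (metis coprime_commute)
qed

text \<open>A Bezout exponent that is 1 modulo \<open>ord w\<close> and 0 modulo
  \<open>ord y\<close> fixes \<open>w\<close> and removes the \<open>y\<close>-part, leaving a power
  of \<open>x\<close>.\<close>

lemma mem_generate_left_of_coprime:
  assumes c: "x \<in> carrier G" "y \<in> carrier G" and comm: "x \<otimes> y = y \<otimes> x"
    and w: "w \<in> generate G {x \<otimes> y}" and "coprime (ord w) (ord y)"
  shows "w \<in> generate G {x}"
proof -
  obtain k :: int where k: "w = (x \<otimes> y) [^] k" using w c by (auto simp: generate_pow)
  have wc: "w \<in> carrier G" using k c by simp
  obtain u v where uv: "u * int (ord w) + v * int (ord y) = 1"
    using bezout_int[of "int (ord w)" "int (ord y)"] assms(5) by auto
  have "1 - v * int (ord y) = u * int (ord w)" using uv by simp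
  then have "w [^] (v * int (ord y)) = w [^] (1::int)"
    using wc by (simp add: int_pow_eq del: int_pow_1)
  then have "w = (x \<otimes> y) [^] (k * (v * int (ord y)))"
    using k c wc by (simp add: int_pow_pow)
  also have "\<dots> = x [^] (k * (v * int (ord y))) \<otimes> y [^] (k * (v * int (ord y)))"
    by (rule int_pow_mult_distrib[OF comm c])
  also have "y [^] (k * (v * int (ord y))) = \<one>" using c by (simp add: int_pow_eq_id)
  finally have "w = x [^] (k * (v * int (ord y)))" using c by simp
  then show ?thesis using c generate_pow[of x] by blast
qed

text \<open>No single cyclic subgroup contains all five vertices, as it would have only one subgroup
  of order \<open>p\<close>. Memberships are therefore checked directly, by splitting off parts of
  coprime order.\<close>

lemma prime_noncyclic_not_perfect:
  assumes nil: "nilpotent_group G"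
    and x: "x \<in> carrier G" "ord x = p" and x': "x' \<in> carrier G" "ord x' = p"
    and y: "y \<in> carrier G" "ord y = q" and z: "z \<in> carrier G" "ord z = r"
    and x'x: "x' \<notin> generate G {x}"
    and pr: "Factorial_Ring.prime (p::nat)" "Factorial_Ring.prime q" "Factorial_Ring.prime r"
    and ne: "p \<noteq> q" "p \<noteq> r" "q \<noteq> r"
  shows "\<not> perfect_graph (diff_vertices G) (diff_adj G)"
proof -
  have cop: "coprime p q" "coprime p r" "coprime q r"
    using pr ne by (simp_all add: primes_coprime)
  have nd: "\<not> p dvd q * r" "\<not> q dvd p * r" "\<not> r dvd p * q"
    using pr ne by (auto simp: prime_dvd_mult_iff dest: primes_dvd_imp_eq)
  have trans: "a \<in> generate G {c}" if "c \<in> carrier G" "b \<in> generate G {c}" "a \<in> generate G {b}" for a b c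
    using that generate_singleton_mono by blast
  have not_one: "a \<noteq> \<one>" if "ord a \<in> {p, q, r}" for a
    using that pr by (metis insertE not_prime_1 ord_id singletonD)
  \<comment> \<open>The common element \<open>w\<close> of prime order witnesses the nontrivial
    intersection; below it is always \<open>y\<close> or \<open>z\<close>.\<close>
  have adjI: "diff_adj G a b"
    if "a \<in> carrier G" "b \<in> carrier G" "w \<in> generate G {a}" "w \<in> generate G {b}" "ord w \<in> {p, q, r}"
      "a \<notin> generate G {b}" "b \<notin> generate G {a}" for a b w
    using that not_one[of w] diff_adj_iff[of a b] by blast
  define t where "t = y \<otimes> z"
  have yz: "y \<otimes> z = z \<otimes> y" using nilpotent_coprime_commute[OF nil y(1) z(1)] y z cop by simp
  have t: "t \<in> carrier G" "ord t = q * r" "y \<in> generate G {t}" "z \<in> generate G {t}"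
    using ord_mult_of_coprime[OF y(1) z(1) yz] mem_generate_mult_of_coprime[OF y(1) z(1) yz] y z cop
    by (simp_all add: t_def)
  \<comment> \<open>\<open>u\<close> stands for either of \<open>x\<close> and \<open>x'\<close>,
    for which all these facts are used.\<close>
  have u: "u \<otimes> y \<in> carrier G" "u \<otimes> z \<in> carrier G" "u \<otimes> t \<in> carrier G"
      "ord (u \<otimes> y) = p * q" "ord (u \<otimes> z) = p * r" "ord (u \<otimes> t) = p * (q * r)"
      "u \<in> generate G {u \<otimes> y}" "y \<in> generate G {u \<otimes> y}"
      "u \<in> generate G {u \<otimes> z}" "z \<in> generate G {u \<otimes> z}"
      "u \<in> generate G {u \<otimes> t}" "t \<in> generate G {u \<otimes> t}"
      "y \<in> generate G {u \<otimes> t}" "z \<in> generate G {u \<otimes> t}"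
      "u \<otimes> y \<in> generate G {u \<otimes> t}" "u \<otimes> z \<in> generate G {u \<otimes> t}"
    and u_part: "\<And>w. w \<in> generate G {u \<otimes> y} \<Longrightarrow> coprime (ord w) q \<Longrightarrow> w \<in> generate G {u}"
      "\<And>w. w \<in> generate G {u \<otimes> z} \<Longrightarrow> coprime (ord w) r \<Longrightarrow> w \<in> generate G {u}"
      "\<And>w. w \<in> generate G {u \<otimes> t} \<Longrightarrow> coprime (ord w) (q * r) \<Longrightarrow> w \<in> generate G {u}"
    if u: "u \<in> carrier G" "ord u = p" for u
  proof -
    have cop_t: "coprime (ord u) (ord t)" using u t cop by simp
    have cop_y: "coprime (ord u) (ord y)" using u y cop by simp
    have cop_z: "coprime (ord u) (ord z)" using u z cop by simp
    have uy: "u \<otimes> y = y \<otimes> u" and uz: "u \<otimes> z = z \<otimes> u" and ut: "u \<otimes> t = t \<otimes> u"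
      using nilpotent_coprime_commute[OF nil u(1)] y(1) z(1) t(1) cop_y cop_z cop_t by blast+
    show c: "u \<otimes> y \<in> carrier G" "u \<otimes> z \<in> carrier G" "u \<otimes> t \<in> carrier G"
      using u y z t by simp_all
    show "ord (u \<otimes> y) = p * q" "ord (u \<otimes> z) = p * r" "ord (u \<otimes> t) = p * (q * r)"
      using ord_mult_of_coprime[OF u(1) y(1) uy cop_y] ord_mult_of_coprime[OF u(1) z(1) uz cop_z]
        ord_mult_of_coprime[OF u(1) t(1) ut cop_t] u y z t by simp_all
    show "u \<in> generate G {u \<otimes> y}" "y \<in> generate G {u \<otimes> y}"
      using mem_generate_mult_of_coprime[OF u(1) y(1) uy cop_y] by simp_all
    show "u \<in> generate G {u \<otimes> z}" "z \<in> generate G {u \<otimes> z}"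
      using mem_generate_mult_of_coprime[OF u(1) z(1) uz cop_z] by simp_all
    show ut_mem: "u \<in> generate G {u \<otimes> t}" "t \<in> generate G {u \<otimes> t}"
      using mem_generate_mult_of_coprime[OF u(1) t(1) ut cop_t] by simp_all
    show yz_mem: "y \<in> generate G {u \<otimes> t}" "z \<in> generate G {u \<otimes> t}"
      using trans[OF c(3) ut_mem(2)] t(3,4) by simp_all
    show "u \<otimes> y \<in> generate G {u \<otimes> t}" "u \<otimes> z \<in> generate G {u \<otimes> t}"
      using generate.eng[OF ut_mem(1)] yz_mem by simp_all
    show "\<And>w. w \<in> generate G {u \<otimes> y} \<Longrightarrow> coprime (ord w) q \<Longrightarrow> w \<in> generate G {u}"
      using mem_generate_left_of_coprime[OF u(1) y(1) uy] y(2) by simp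
    show "\<And>w. w \<in> generate G {u \<otimes> z} \<Longrightarrow> coprime (ord w) r \<Longrightarrow> w \<in> generate G {u}"
      using mem_generate_left_of_coprime[OF u(1) z(1) uz] z(2) by simp
    show "\<And>w. w \<in> generate G {u \<otimes> t} \<Longrightarrow> coprime (ord w) (q * r) \<Longrightarrow> w \<in> generate G {u}"
      using mem_generate_left_of_coprime[OF u(1) t(1) ut] t(2) by simp
  qed
  note X = u[OF x] and X' = u[OF x']
  have p0: "p \<noteq> 0" using pr(1) by auto
  \<comment> \<open>A nontrivial common element has order \<open>p\<close> and so generates
    \<open>x'\<close>, which would put \<open>x'\<close> among the powers of
    \<open>x\<close>.\<close>
  have triv: "w = \<one>" if w: "w \<in> generate G {x}" "w \<in> generate G {x'}" for w
  proof (rule ccontr)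
    assume w1: "w \<noteq> \<one>"
    have wc: "w \<in> carrier G" using w(1) x(1) generate_in_carrier[of "{x}" w] by simp
    have "ord w dvd p" using ord_dvd_of_mem_generate[OF x(1) w(1)] x(2) by simp
    moreover have "ord w \<noteq> 1" using w1 ord_eq_1[OF wc] by simp
    ultimately have "ord w = p" using pr(1) by (auto simp: prime_nat_iff)
    then have "x' \<in> generate G {w}"
      using mem_generate_iff_ord_dvd[OF x'(1), of x' w] w(2) x'(2) p0 generate.incl[of x' "{x'}" G] by simp
    then show False using trans[OF x(1) w(1)] x'x by blast
  qed
  have xx': "x \<notin> generate G {x'}"
    using triv[of x] generate.incl[of x "{x}" G] not_one[of x] x(2) by auto
  \<comment> \<open>Since \<open>p\<close> is coprime to \<open>q * r\<close>, elements of order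
    \<open>p\<close> generated by \<open>x \<otimes> t\<close> are already powers of
    \<open>x\<close>, and likewise for \<open>x'\<close>.\<close>
  have sep: "x' \<notin> generate G {x \<otimes> t}" "x \<notin> generate G {x' \<otimes> t}"
    using u_part(3)[OF x, of x'] u_part(3)[OF x', of x] x'x xx' x(2) x'(2) cop by auto
  have ords: "a \<notin> generate G {b}" if "b \<in> carrier G" "\<not> ord a dvd ord b" for a b
    using ord_dvd_of_mem_generate that by blast
  have nm: "c \<notin> generate G {b}" if "b \<in> carrier G" "a \<in> generate G {c}" "a \<notin> generate G {b}" for a b c
    using trans that by blast
  have nd2: "\<not> p * q dvd q * r" "\<not> q * r dvd p * q" "\<not> q * r dvd p * r" "\<not> p * r dvd q * r"
     "\<not> p * (q * r) dvd p * q" "\<not> p * (q * r) dvd p * r"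
    using nd by (meson dvd_mult_left dvd_mult_right)+
  \<comment> \<open>The order of a common element divides \<open>gcd (p * q) (p * r) = p\<close>, so
    the element is a power of both \<open>x'\<close> and \<open>x\<close>.\<close>
  have BD: "generate G {x' \<otimes> y} \<inter> generate G {x \<otimes> z} = {\<one>}"
  proof -
    have "w = \<one>" if w: "w \<in> generate G {x' \<otimes> y}" "w \<in> generate G {x \<otimes> z}" for w
    proof -
      have "ord w dvd p * q" "ord w dvd p * r"
        using ord_dvd_of_mem_generate[OF X'(1) w(1)] ord_dvd_of_mem_generate[OF X(2) w(2)] X'(4) X(5)
        by simp_all
      then have "ord w dvd gcd (p * q) (p * r)" by simp
      also have "gcd (p * q) (p * r) = p" using cop(3) by (simp add: gcd_mult_distrib_nat[symmetric])
      finally have "ord w dvd p" .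
      then have "coprime (ord w) q" "coprime (ord w) r"
        using cop coprime_divisors[OF _ dvd_refl] by blast+
      then show ?thesis using triv u_part(1)[OF x' w(1)] u_part(2)[OF x w(2)] by blast
    qed
    then show ?thesis by (auto intro: generate.one)
  qed
  show ?thesis
  \<comment> \<open>Four of the non-edges hold because one vertex is a power of the other; the fifth
    is \<open>BD\<close>.\<close>
  proof (rule induced_pentagon_diff_graph_not_perfect[of "x \<otimes> t" "x' \<otimes> y" t "x \<otimes> z" "x' \<otimes> t"])
    show "diff_adj G (x \<otimes> t) (x' \<otimes> y)"
      using X(3,13) X'(1,8) y(2) nm[OF X'(1) X(14)] ords[of "x' \<otimes> y" z] nm[OF X(3) X'(7) sep(1)] nd(3) z(2) X'(4)
      by (intro adjI[of _ _ y]) auto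
    show "diff_adj G (x' \<otimes> y) t"
      using X'(1,4,8) t(1,2,3) y(2) ords nd2 by (intro adjI[of _ _ y]) auto
    show "diff_adj G t (x \<otimes> z)"
      using X(2,5,10) t(1,2,4) z(2) ords nd2 by (intro adjI[of _ _ z]) auto
    show "diff_adj G (x \<otimes> z) (x' \<otimes> t)"
      using X(2,5,10) X'(3,6,14) z(2) ords nd2 nm[OF X'(3) X(9) sep(2)] by (intro adjI[of _ _ z]) auto
    show "diff_adj G (x' \<otimes> t) (x \<otimes> t)"
      using X(3,13) X'(3,13) y(2) nm[OF X'(3) X(11) sep(2)] nm[OF X(3) X'(11) sep(1)]
      by (intro adjI[of _ _ y]) auto
    show "\<not> diff_adj G (x \<otimes> t) t" using diff_adj_iff[OF X(3) t(1)] X(12) by blast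
    show "\<not> diff_adj G (x \<otimes> t) (x \<otimes> z)" using diff_adj_iff[OF X(3) X(2)] X(16) by blast
    show "\<not> diff_adj G (x' \<otimes> y) (x \<otimes> z)" using diff_adj_iff[OF X'(1) X(2)] BD by blast
    show "\<not> diff_adj G (x' \<otimes> y) (x' \<otimes> t)" using diff_adj_iff[OF X'(1) X'(3)] X'(15) by blast
    show "\<not> diff_adj G t (x' \<otimes> t)" using diff_adj_iff[OF t(1) X'(3)] X'(12) by blast
  qed
qed

section \<open>Perfection forces the group to be cyclic of order \<open>p * q * r\<close>\<close>

lemma nilpotent_exists_ord_mult:
  assumes "nilpotent_group G" and "\<exists>x \<in> carrier G. ord x = m" "\<exists>x \<in> carrier G. ord x = n" "coprime m n"
  shows "\<exists>x \<in> carrier G. ord x = m * n"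
proof -
  obtain x y where x: "x \<in> carrier G" "ord x = m" and y: "y \<in> carrier G" "ord y = n"
    using assms by blast
  then have cop: "coprime (ord x) (ord y)" using assms(4) by simp
  then have "ord (x \<otimes> y) = m * n"
    using ord_mult_of_coprime[OF x(1) y(1)] nilpotent_coprime_commute[OF assms(1) x(1) y(1)] x y by simp
  then show ?thesis using x(1) y(1) by blast
qed

lemma nilpotent_prime_square_not_perfect:
  assumes nil: "nilpotent_group G" and fin: "finite (carrier G)"
    and pr: "Factorial_Ring.prime (p::nat)" "Factorial_Ring.prime q" "Factorial_Ring.prime r"
    and ne: "p \<noteq> q" "p \<noteq> r" "q \<noteq> r"
    and dvd: "p * p dvd order G" "q dvd order G" "r dvd order G"
  shows "\<not> perfect_graph (diff_vertices G) (diff_adj G)"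
proof -
  have cop: "coprime p q" "coprime p r" "coprime q r"
    using pr ne by (simp_all add: primes_coprime)
  have y: "\<exists>y \<in> carrier G. ord y = q" and z: "\<exists>z \<in> carrier G. ord z = r"
    using cauchy_prime_order[OF fin] pr dvd by blast+
  from ord_prime_square_or_noncyclic[OF fin pr(1) dvd(1)] show ?thesis
  proof
    assume x: "\<exists>x \<in> carrier G. ord x = p * p"
    have "\<exists>g \<in> carrier G. ord g = p * p * q"
      using nilpotent_exists_ord_mult[OF nil x y] cop by simp
    then have "\<exists>g \<in> carrier G. ord g = p * p * q * r"
      using nilpotent_exists_ord_mult[OF nil _ z] cop by simp
    then show ?thesis using prime_square_not_perfect pr ne by blast
  next
    assume "\<exists>x \<in> carrier G. \<exists>x' \<in> carrier G. ord x = p \<and> ord x' = p \<and> x' \<notin> generate G {x}"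
    then show ?thesis using prime_noncyclic_not_perfect[OF nil] y z pr ne by blast
  qed
qed

lemma nilpotent_four_primes_not_perfect:
  assumes nil: "nilpotent_group G" and fin: "finite (carrier G)"
    and pr: "Factorial_Ring.prime (p::nat)" "Factorial_Ring.prime q" "Factorial_Ring.prime r" "Factorial_Ring.prime s"
    and ne: "p \<noteq> q" "p \<noteq> r" "p \<noteq> s" "q \<noteq> r" "q \<noteq> s" "r \<noteq> s"
    and dvd: "p dvd order G" "q dvd order G" "r dvd order G" "s dvd order G"
  shows "\<not> perfect_graph (diff_vertices G) (diff_adj G)"
proof -
  have cop: "coprime p q" "coprime p r" "coprime p s" "coprime q r" "coprime q s" "coprime r s"
    using pr ne by (simp_all add: primes_coprime)
  note C = cauchy_prime_order[OF fin]
  have "\<exists>g \<in> carrier G. ord g = p * q"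
    using nilpotent_exists_ord_mult[OF nil C[OF pr(1) dvd(1)] C[OF pr(2) dvd(2)]] cop by simp
  then have "\<exists>g \<in> carrier G. ord g = p * q * r"
    using nilpotent_exists_ord_mult[OF nil _ C[OF pr(3) dvd(3)]] cop by simp
  then have "\<exists>g \<in> carrier G. ord g = p * q * r * s"
    using nilpotent_exists_ord_mult[OF nil _ C[OF pr(4) dvd(4)]] cop by simp
  then show ?thesis using four_primes_not_perfect pr ne by blast
qed

lemma iso_integer_mod_group_of_perfect:
  assumes nil: "nilpotent_group G" and fin: "finite (carrier G)"
    and pr: "Factorial_Ring.prime (p::nat)" "Factorial_Ring.prime q" "Factorial_Ring.prime r"
    and ne: "p \<noteq> q" "p \<noteq> r" "q \<noteq> r"
    and dvd: "p dvd order G" "q dvd order G" "r dvd order G"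
    and perfect: "perfect_graph (diff_vertices G) (diff_adj G)"
  shows "G \<cong> integer_mod_group (p * q * r)"
proof -
  have cop: "coprime p q" "coprime p r" "coprime q r"
    using pr ne by (simp_all add: primes_coprime)
  have "p * q * r dvd order G" using dvd cop by (intro divides_mult) auto
  then obtain k where k: "order G = p * q * r * k" by blast
  \<comment> \<open>A prime factor of \<open>k\<close> is either a fourth prime or one of
    \<open>p\<close>, \<open>q\<close>, \<open>r\<close>, whose square then divides the order. The
    square lemma is instantiated once for each of the three.\<close>
  have "k = 1"
  proof (rule ccontr)
    assume "k \<noteq> 1"
    then obtain s where s: "Factorial_Ring.prime s" "s dvd k" using prime_factor_nat by blast
    have "s dvd order G" using s k by simp
    moreover have "s * s dvd order G" if "s \<in> {p, q, r}"
    proof -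
      have "s dvd p * q * r" using that by auto
      then show ?thesis using s(2) k mult_dvd_mono by metis
    qed
    ultimately show False
      using perfect nilpotent_four_primes_not_perfect[OF nil fin pr s(1) ne(1,2) _ ne(3) _ _ dvd]
        nilpotent_prime_square_not_perfect[OF nil fin pr ne _ dvd(2,3)]
        nilpotent_prime_square_not_perfect[OF nil fin pr(2,1,3) ne(1)[symmetric] ne(3,2) _ dvd(1,3)]
        nilpotent_prime_square_not_perfect[OF nil fin pr(3,1,2) ne(2)[symmetric] ne(3)[symmetric] ne(1) _ dvd(1,2)]
      by blast
  qed
  then have order: "order G = p * q * r" using k by simp
  note C = cauchy_prime_order[OF fin]
  have "\<exists>g \<in> carrier G. ord g = p * q"
    using nilpotent_exists_ord_mult[OF nil C[OF pr(1) dvd(1)] C[OF pr(2) dvd(2)]] cop by simp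
  then have "\<exists>g \<in> carrier G. ord g = p * q * r"
    using nilpotent_exists_ord_mult[OF nil _ C[OF pr(3) dvd(3)]] cop by simp
  then show ?thesis using iso_integer_mod_group_of_ord_eq_order[OF fin] order by metis
qed

end

section \<open>Perfection for the cyclic group, and the equivalence\<close>

lemma dvd_prime_mult_cases:
  assumes "Factorial_Ring.prime (p::nat)" "m dvd p * n"
  shows "m dvd n \<or> (\<exists>k. m = p * k \<and> k dvd n)"
proof (cases "p dvd m")
  case True
  then obtain k where "m = p * k" by blast
  with assms show ?thesis by auto
next
  case False
  then have "coprime m p" using assms(1) prime_imp_coprime coprime_commute by blast
  with assms(2) show ?thesis by (simp add: coprime_dvd_mult_right_iff)
qed

lemma divisors_of_three_primes:
  assumes "Factorial_Ring.prime (p::nat)" "Factorial_Ring.prime q" "Factorial_Ring.prime r" "m dvd p * q * r"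
  shows "m \<in> {1, p, q, r, p * q, p * r, q * r, p * q * r}"
proof -
  have r: "k = 1 \<or> k = r" if "k dvd r" for k using assms(3) that by (auto simp: prime_nat_iff)
  have qr: "k \<in> {1, q, r, q * r}" if k: "k dvd q * r" for k
  proof -
    consider "k dvd r" | l where "k = q * l" "l dvd r"
      using dvd_prime_mult_cases[OF assms(2) k] by blast
    then show ?thesis
    proof cases
      case 1
      then show ?thesis using r by blast
    next
      case 2
      then show ?thesis using r[of l] by auto
    qed
  qed
  consider "m dvd q * r" | l where "m = p * l" "l dvd q * r"
    using dvd_prime_mult_cases[OF assms(1), of m "q * r"] assms(4) by (auto simp: mult.assoc)
  then show ?thesis
  proof cases
    case 1
    then show ?thesis using qr by blast
  next
    case 2
    then show ?thesis using qr[of l] by (auto simp: mult.assoc)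
  qed
qed

text \<open>Only three orders occur among the vertices. Any two different ones share a prime and
  neither divides the other, so the order is the class label of a complete multipartite
  graph.\<close>

lemma (in group) perfect_of_iso_integer_mod_group:
  assumes pr: "Factorial_Ring.prime (p::nat)" "Factorial_Ring.prime q" "Factorial_Ring.prime r"
    and ne: "p \<noteq> q" "p \<noteq> r" "q \<noteq> r" and fin: "finite (carrier G)"
    and iso: "G \<cong> integer_mod_group (p * q * r)"
  shows "perfect_graph (diff_vertices G) (diff_adj G)"
proof -
  let ?n = "p * q * r"
  have "q * r > 0" using pr by (simp add: prime_gt_0_nat)
  then have "p * (q * r) > 1" using prime_gt_1_nat[OF pr(1)]
    by (metis less_1_mult nat_mult_1_right neq0_conv less_one linorder_neqE_nat)
  then have "?n > 1" by (simp add: mult.assoc)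
  then obtain g where g: "g \<in> carrier G" "ord g = ?n" "carrier G = generate G {g}"
    using exists_ord_of_iso_integer_mod_group[OF iso] by blast
  have adj: "diff_adj G x y \<longleftrightarrow> \<not> coprime (ord x) (ord y) \<and> \<not> ord x dvd ord y \<and> \<not> ord y dvd ord x"
    if "x \<in> carrier G" "y \<in> carrier G" for x y
    using diff_adj_cyclic_iff[OF g(1)] g(2,3) that \<open>?n > 1\<close> by (metis not_one_less_zero)
  have ord_dvd: "ord x dvd ?n" if "x \<in> carrier G" for x
    using ord_dvd_of_mem_generate[OF g(1)] g that by simp
  have ords: "ord x \<in> {p * q, p * r, q * r}" if "x \<in> diff_vertices G" for x
  proof -
    from that obtain y where x: "x \<in> carrier G" and y: "y \<in> carrier G" and xy: "diff_adj G x y"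
      unfolding diff_vertices_def diff_adj_def ipg_adj_def by blast
    \<comment> \<open>A neighbour excludes order 1 and prime orders, which are coprime to the other
      order or divide it, and also the full order, which every order divides.\<close>
    note inc = xy[unfolded adj[OF x y]]
    have "\<not> Factorial_Ring.prime (ord x)" using inc prime_imp_coprime by blast
    moreover have "ord x \<noteq> 1" using inc by auto
    moreover have "ord x \<noteq> ?n" using inc ord_dvd[OF y] by metis
    ultimately show ?thesis using divisors_of_three_primes[OF pr ord_dvd[OF x]] pr by auto
  qed
  have nd: "\<not> p dvd q * r" "\<not> q dvd p * r" "\<not> r dvd p * q"
    using pr ne by (auto simp: prime_dvd_mult_iff dest: primes_dvd_imp_eq)
  have not1: "p \<noteq> Suc 0" "q \<noteq> Suc 0" "r \<noteq> Suc 0" using pr by auto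
  have nd2: "\<not> p * q dvd q * r" "\<not> q * r dvd p * q" "\<not> q * r dvd p * r" "\<not> p * r dvd q * r"
     "\<not> p * q dvd p * r" "\<not> p * r dvd p * q"
    using nd by (meson dvd_mult_left dvd_mult_right)+
  show ?thesis
  proof (rule complete_multipartite_perfect[where c = ord])
    show "finite (diff_vertices G)" using fin by (simp add: diff_vertices_def)
    fix x y assume xy: "x \<in> diff_vertices G" "y \<in> diff_vertices G"
    have c: "x \<in> carrier G" "y \<in> carrier G" using xy by (simp_all add: diff_vertices_def)
    show "diff_adj G x y \<longleftrightarrow> ord x \<noteq> ord y"
      unfolding adj[OF c] using ords[OF xy(1)] ords[OF xy(2)] nd2 not1 by auto
  qed
qed

theorem theorem7p1:
  fixes G :: "('a, 'b) monoid_scheme"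
  assumes "nilpotent_group G"
    and "finite (carrier G)"
    and "card (prime_factors (order G)) \<ge> 3"
  shows "perfect_graph (diff_vertices G) (diff_adj G) \<longleftrightarrow>
    (\<exists>p1 p2 p3. Factorial_Ring.prime (p1::nat) \<and> Factorial_Ring.prime p2 \<and> Factorial_Ring.prime p3 \<and> p1 \<noteq> p2 \<and> p1 \<noteq> p3 \<and> p2 \<noteq> p3 \<and>
       G \<cong> integer_mod_group (p1 * p2 * p3))"
proof
  interpret group G using assms(1) by (simp add: nilpotent_group_def)
  show "perfect_graph (diff_vertices G) (diff_adj G)"
    if "\<exists>p1 p2 p3. Factorial_Ring.prime (p1::nat) \<and> Factorial_Ring.prime p2 \<and> Factorial_Ring.prime p3 \<and> p1 \<noteq> p2 \<and> p1 \<noteq> p3 \<and> p2 \<noteq> p3 \<and>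
       G \<cong> integer_mod_group (p1 * p2 * p3)"
    using that perfect_of_iso_integer_mod_group[OF _ _ _ _ _ _ assms(2)] by blast
  assume perfect: "perfect_graph (diff_vertices G) (diff_adj G)"
  obtain T where T: "T \<subseteq> prime_factors (order G)" "card T = 3"
    using obtain_subset_with_card_n[OF assms(3)] by blast
  then obtain p q r where pqr: "T = {p, q, r}" "p \<noteq> q" "p \<noteq> r" "q \<noteq> r"
    by (auto simp: card_3_iff)
  with T(1) have "Factorial_Ring.prime p" "Factorial_Ring.prime q" "Factorial_Ring.prime r"
    "p dvd order G" "q dvd order G" "r dvd order G" by auto
  with pqr(2-) perfect show "\<exists>p1 p2 p3. Factorial_Ring.prime (p1::nat) \<and> Factorial_Ring.prime p2 \<and> Factorial_Ring.prime p3 \<and> p1 \<noteq> p2 \<and> p1 \<noteq> p3 \<and> p2 \<noteq> p3 \<and>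
       G \<cong> integer_mod_group (p1 * p2 * p3)"
    using iso_integer_mod_group_of_perfect[OF assms(1,2)] by blast
qed

end
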